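(* Let $n\ge1$, let $\mathcal{E}$ be a Hilbert space with orthonormal basis $\{h_s\}_{s\in\Lambda}$ ($\Lambda$ finite or countable), and let $W_L\in\mathcal{B}(\mathcal{F}_n^2\otimes\mathcal{E})$ be the odometer map with symbol $L\in\mathcal{B}(\mathcal{E},\mathcal{F}_n^2\otimes\mathcal{E})$. Then, for every $\gamma\in F_n^+$ and $l\in\Lambda$, $$W_L^*(e_\gamma\otimes h_l)=\chi_{\mathcal{M}_0}(\gamma)\,(e_{\gamma-1}\otimes h_l)+\sum_{p=0}^{\gamma(1)}\sum_{q\in\Lambda}\overline{c^{h_q}_{\gamma^{(p)},l}}\,(e_n^p\otimes h_q)$$ $$=\chi_{\mathcal{M}_0}(\gamma)\,(e_{\gamma-1}\otimes h_l)+\sum_{p=0}^{\gamma(1)}e_n^p\otimes L^*(e_{\gamma^{(p)}}\otimes h_l),$$ where $\chi_{\mathcal{M}_0}$ denotes the characteristic function of $\mathcal{M}_0$.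
   Context: Hilbert spaces are separable and complex, inner products linear in the first variable; $\mathcal{B}(\mathcal{H},\mathcal{K})$ denotes bounded linear operators. $F_n^+$ is the free monoid of words $\mu=\mu_1\cdots\mu_m$ in the letters $1,\dots,n$, with empty word $\emptyset$ and length $|\mu|$. The full Fock space $\mathcal{F}_n^2=\mathbb{C}\Omega\oplus\bigoplus_{k\ge1}(\mathbb{C}^n)^{\otimes k}$ has orthonormal basis $e_\mu=e_{\mu_1}\otimes\cdots\otimes e_{\mu_m}$, $\mu\in F_n^+$, with $e_\emptyset=\Omega$; $e_k^m:=e_k^{\otimes m}$, $e_k^0=\Omega$, and $\Omega$ acts as a unit for left tensoring (so $e_n^0\otimes\xi=\Omega\otimes\xi$ for $\xi\in\mathcal{E}$). For $f\in\mathcal{F}_n^2\otimes\mathcal{E}$, $e_1^p\otimes f$ means left tensoring by $e_1^p$. Odometer map: for $L\in\mathcal{B}(\mathcal{E},\mathcal{F}_n^2\otimes\mathcal{E})$, $W_L$ is the operator on $\mathcal{F}_n^2\otimes\mathcal{E}$ given by $W_L(\Omega\otimes\eta)=L\eta$; $W_L(e_n^m\otimes\eta)=e_1^m\otimes L\eta$ for $m\ge1$; and, for a nonempty word $\mu=\mu_1\cdots\mu_m$ having some letter $\ne n$, with $k$ the smallest index such that $\mu_k\neq n$, $W_L(e_\mu\otimes\eta)=e_1^{k-1}\otimes e_{\mu_k+1}\otimes e_{\mu_{k+1}}\otimes\cdots\otimes e_{\mu_m}\otimes\eta$. It is a standing assumption that $W_L$ is a bounded operator on $\mathcal{F}_n^2\otimes\mathcal{E}$.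 $\mathcal{M}_0=\{\mu\in F_n^+:|\mu|\ge1,\ \mu_i\ne1\text{ for some }i\}$. For $\gamma=\gamma_1\cdots\gamma_m\in\mathcal{M}_0$ with $k$ the smallest index such that $\gamma_k\ne1$, $e_{\gamma-1}:=e_n^{k-1}\otimes e_{\gamma_k-1}\otimes e_{\gamma_{k+1}}\otimes\cdots\otimes e_{\gamma_m}$ (the term with $\chi_{\mathcal{M}_0}(\gamma)$ is absent when $\gamma\notin\mathcal{M}_0$). Every $e_\gamma$ can be written uniquely as $e_\gamma=e_1^p\otimes e_{\gamma'}$ with $p\ge0$ and either $\gamma'=\emptyset$ or $\gamma'_1\ne1$; set $\gamma(1):=p$ and, for $0\le m\le p$, $e_{\gamma^{(m)}}:=e_1^{p-m}\otimes e_{\gamma'}$ (so $\gamma^{(m)}$ is the word obtained from $\gamma$ by deleting its first $m$ letters). For $\mu\in F_n^+$ and $q,s\in\Lambda$, $c^{h_q}_{\mu,s}:=\langle Lh_q,e_\mu\otimes h_s\rangle$. *)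

theory Defs
  imports "HOL-Analysis.Analysis"
begin

section \<open>Complex Hilbert spaces\<close>

class complex_inner = real_normed_vector +
  fixes scaleC :: "complex \<Rightarrow> 'a \<Rightarrow> 'a"  (infixr "*\<^sub>C" 75)
    and cinner :: "'a \<Rightarrow> 'a \<Rightarrow> complex"
  assumes scaleC_add_right: "a *\<^sub>C (x + y) = a *\<^sub>C x + a *\<^sub>C y"
    and scaleC_add_left: "(a + b) *\<^sub>C x = a *\<^sub>C x + b *\<^sub>C x"
    and scaleC_scaleC: "a *\<^sub>C b *\<^sub>C x = (a * b) *\<^sub>C x"
    and scaleC_of_real: "complex_of_real r *\<^sub>C x = r *\<^sub>R x"
    and cinner_add_left: "cinner (x + y) z = cinner x z + cinner y z"
    and cinner_scaleC_left: "cinner (a *\<^sub>C x) y = a * cinner x y"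
    and cinner_commute: "cinner x y = cnj (cinner y x)"
    and cinner_self: "cinner x x = complex_of_real ((norm x)\<^sup>2)"

class chilbert_space = complex_inner + complete_space

global_interpretation complex_vector: vector_space "scaleC :: complex \<Rightarrow> 'a \<Rightarrow> 'a::complex_inner"
proof unfold_locales
  show "1 *\<^sub>C x = x" for x :: 'a
    using scaleC_of_real[of 1 x] by simp
qed (rule scaleC_add_right scaleC_add_left scaleC_scaleC)+

instantiation complex :: chilbert_space
begin
definition scaleC_complex :: "complex \<Rightarrow> complex \<Rightarrow> complex"
  where "scaleC_complex a x = a * x"
definition cinner_complex :: "complex \<Rightarrow> complex \<Rightarrow> complex"
  where "cinner_complex x y = x * cnj y"
instance
proof
  fix a b x y z :: complex and r :: real
  show "a *\<^sub>C (x + y) = a *\<^sub>C x + a *\<^sub>C y" "(a + b) *\<^sub>C x = a *\<^sub>C x + b *\<^sub>C x"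
    "a *\<^sub>C b *\<^sub>C x = (a * b) *\<^sub>C x" "complex_of_real r *\<^sub>C x = r *\<^sub>R x"
    by (simp_all add: scaleC_complex_def algebra_simps scaleR_conv_of_real)
  show "cinner (x + y) z = cinner x z + cinner y z" "cinner (a *\<^sub>C x) y = a * cinner x y"
    "cinner x y = cnj (cinner y x)"
    by (simp_all add: scaleC_complex_def cinner_complex_def algebra_simps)
  show "cinner x x = complex_of_real ((norm x)\<^sup>2)"
    unfolding cinner_complex_def by (rule complex_norm_square[symmetric])
qed
end

lemma cinner_add_right: "cinner x (y + z) = cinner x y + cinner x z"
  for x :: "'a::complex_inner"
  by (metis cinner_add_left cinner_commute complex_cnj_add)

lemma cinner_scaleC_right: "cinner x (a *\<^sub>C y) = cnj a * cinner x y"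
  for x :: "'a::complex_inner"
  by (metis cinner_scaleC_left cinner_commute complex_cnj_mult)

lemma norm_scaleC: "norm (a *\<^sub>C x) = cmod a * norm x" for x :: "'a::complex_inner"
proof -
  have "complex_of_real ((norm (a *\<^sub>C x))\<^sup>2) = a * cnj a * cinner x x"
    unfolding cinner_self[symmetric] by (simp add: cinner_scaleC_left cinner_scaleC_right)
  also have "\<dots> = complex_of_real ((cmod a * norm x)\<^sup>2)"
    by (simp only: cinner_self complex_norm_square[symmetric] power_mult_distrib of_real_mult)
  finally have "(norm (a *\<^sub>C x))\<^sup>2 = (cmod a * norm x)\<^sup>2"
    unfolding of_real_eq_iff .
  then show ?thesis by (simp add: power2_eq_iff_nonneg)
qed

lemma cinner_bound: "cmod (cinner x y) \<le> (norm x)\<^sup>2 + (norm y)\<^sup>2"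
  for x :: "'a::complex_inner"
proof (cases "cinner x y = 0")
  case False
  define c where "c = - sgn (cinner x y)"
  have c: "cmod c = 1" using False by (simp add: c_def norm_sgn)
  have s: "cnj (sgn z) * z = complex_of_real (cmod z)" for z :: complex
    by (cases "z = 0")
      (auto simp: sgn_eq mult.commute[of "cnj z"] complex_norm_square[symmetric] power2_eq_square)
  have "complex_of_real ((norm (x + c *\<^sub>C y))\<^sup>2) =
      cinner x x + cnj c * cinner x y + (c * cnj (cinner x y) + c * cnj c * cinner y y)"
    unfolding cinner_self[symmetric]
    by (simp add: cinner_add_left cinner_add_right cinner_scaleC_left cinner_scaleC_right
        cinner_commute[of y x] algebra_simps)
  also have "c * cnj (cinner x y) = cnj (cnj c * cinner x y)" by simp
  also have "cnj c * cinner x y = - complex_of_real (cmod (cinner x y))"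
    using s[of "cinner x y"] by (simp add: c_def)
  also have "c * cnj c = 1" using c by (simp add: complex_norm_square[symmetric])
  finally have "complex_of_real ((norm (x + c *\<^sub>C y))\<^sup>2) =
      complex_of_real ((norm x)\<^sup>2 - 2 * cmod (cinner x y) + (norm y)\<^sup>2)"
    by (simp add: cinner_self)
  then have "(norm (x + c *\<^sub>C y))\<^sup>2 = (norm x)\<^sup>2 - 2 * cmod (cinner x y) + (norm y)\<^sup>2"
    unfolding of_real_eq_iff .
  then have "0 \<le> (norm x)\<^sup>2 - 2 * cmod (cinner x y) + (norm y)\<^sup>2"
    by (metis zero_le_power2)
  then show ?thesis using norm_ge_zero[of "cinner x y"] by linarith
qed simp

definition bounded_clinear :: "('a::complex_inner \<Rightarrow> 'b::complex_inner) \<Rightarrow> bool"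
  where "bounded_clinear T \<longleftrightarrow> bounded_linear T \<and> (\<forall>a x. T (a *\<^sub>C x) = a *\<^sub>C T x)"

definition cadjoint :: "('a::chilbert_space \<Rightarrow> 'b::chilbert_space) \<Rightarrow> 'b \<Rightarrow> 'a"
  where "cadjoint T = (THE S. \<forall>x y. cinner (T x) y = cinner x (S y))"

definition orthonormal_basis :: "'i set \<Rightarrow> ('i \<Rightarrow> 'a::chilbert_space) \<Rightarrow> bool"
  where "orthonormal_basis I b \<longleftrightarrow>
    (\<forall>i\<in>I. \<forall>j\<in>I. cinner (b i) (b j) = (if i = j then 1 else 0)) \<and>
    closure (complex_vector.span (b ` I)) = UNIV"

section \<open>Square-summable families of vectors\<close>

typedef (overloaded) ('i, 'a) ell2 =
  "{f :: 'i \<Rightarrow> 'a::complex_inner. (\<lambda>i. (norm (f i))\<^sup>2) summable_on UNIV}"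
  morphisms coord Abs_ell2
  by (intro exI[of _ "\<lambda>_. 0"]) simp

setup_lifting type_definition_ell2

lemma ell2_iff_bounded:
  "(\<lambda>i. (norm (f i))\<^sup>2) summable_on UNIV \<longleftrightarrow>
    (\<exists>B. \<forall>F. finite F \<longrightarrow> L2_set (\<lambda>i. norm (f i)) F \<le> B)"
proof
  assume s: "(\<lambda>i. (norm (f i))\<^sup>2) summable_on UNIV"
  have "L2_set (\<lambda>i. norm (f i)) F \<le> sqrt (\<Sum>\<^sub>\<infinity>i. (norm (f i))\<^sup>2)" if "finite F" for F
    unfolding L2_set_def using finite_sum_le_infsum[OF s that] by simp
  then show "\<exists>B. \<forall>F. finite F \<longrightarrow> L2_set (\<lambda>i. norm (f i)) F \<le> B" by blast
next
  assume "\<exists>B. \<forall>F. finite F \<longrightarrow> L2_set (\<lambda>i. norm (f i)) F \<le> B"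
  then obtain B where B: "L2_set (\<lambda>i. norm (f i)) F \<le> B" if "finite F" for F by blast
  have "(\<Sum>i\<in>F. (norm (f i))\<^sup>2) \<le> B\<^sup>2" if "finite F" for F
    using B[OF that] unfolding L2_set_def
    by (meson real_le_lsqrt real_sqrt_ge_zero sqrt_le_D sum_nonneg zero_le_power2)
  then show "(\<lambda>i. (norm (f i))\<^sup>2) summable_on UNIV"
    by (intro nonneg_bdd_above_summable_on bdd_aboveI2[where M="B\<^sup>2"]) auto
qed

lemma summable_norm2_add:
  assumes "(\<lambda>i. (norm (f i))\<^sup>2) summable_on UNIV" "(\<lambda>i. (norm (g i))\<^sup>2) summable_on UNIV"
  shows "(\<lambda>i. (norm (f i + g i :: 'a::real_normed_vector))\<^sup>2) summable_on UNIV"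
proof -
  have "(norm (x + y))\<^sup>2 \<le> 2 * (norm x)\<^sup>2 + 2 * (norm y)\<^sup>2" for x y :: 'a
  proof -
    have "(norm (x + y))\<^sup>2 \<le> (norm x + norm y)\<^sup>2"
      by (intro power_mono norm_triangle_ineq) simp
    also have "\<dots> \<le> 2 * (norm x)\<^sup>2 + 2 * (norm y)\<^sup>2"
      using zero_le_power2[of "norm x - norm y"] by (simp add: power2_eq_square algebra_simps)
    finally show ?thesis .
  qed
  moreover have "(\<lambda>i. 2 * (norm (f i))\<^sup>2 + 2 * (norm (g i))\<^sup>2) summable_on UNIV"
    using assms by (intro summable_on_add summable_on_cmult_right)
  ultimately show ?thesis
    using summable_on_comparison_test by (metis (no_types, lifting) zero_le_power2)
qed

lemma summable_norm2_scaleC: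
  assumes "(\<lambda>i. (norm (f i))\<^sup>2) summable_on UNIV"
  shows "(\<lambda>i. (norm (a *\<^sub>C f i))\<^sup>2) summable_on UNIV"
  using assms by (simp add: norm_scaleC power_mult_distrib summable_on_cmult_right)

lemma summable_cinner:
  fixes f g :: "'i \<Rightarrow> 'a::complex_inner"
  assumes "(\<lambda>i. (norm (f i))\<^sup>2) summable_on UNIV" "(\<lambda>i. (norm (g i))\<^sup>2) summable_on UNIV"
  shows "(\<lambda>i. cinner (f i) (g i)) summable_on UNIV"
proof (rule abs_summable_summable, rule summable_on_comparison_test)
  show "(\<lambda>i. (norm (f i))\<^sup>2 + (norm (g i))\<^sup>2) summable_on UNIV"
    using assms by (rule summable_on_add)
qed (simp_all add: cinner_bound)

instantiation ell2 :: (type, complex_inner) complex_inner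
begin

lift_definition zero_ell2 :: "('a, 'b) ell2" is "\<lambda>_. 0" by simp
lift_definition plus_ell2 :: "('a, 'b) ell2 \<Rightarrow> ('a, 'b) ell2 \<Rightarrow> ('a, 'b) ell2"
  is "\<lambda>f g i. f i + g i" by (simp add: summable_norm2_add)
lift_definition uminus_ell2 :: "('a, 'b) ell2 \<Rightarrow> ('a, 'b) ell2"
  is "\<lambda>f i. - f i" by simp
lift_definition minus_ell2 :: "('a, 'b) ell2 \<Rightarrow> ('a, 'b) ell2 \<Rightarrow> ('a, 'b) ell2"
  is "\<lambda>f g i. f i - g i"
  using summable_norm2_add[of _ "\<lambda>i. - (_ i)"] by simp
lift_definition scaleC_ell2 :: "complex \<Rightarrow> ('a, 'b) ell2 \<Rightarrow> ('a, 'b) ell2"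
  is "\<lambda>a f i. a *\<^sub>C f i" by (simp add: summable_norm2_scaleC)
lift_definition scaleR_ell2 :: "real \<Rightarrow> ('a, 'b) ell2 \<Rightarrow> ('a, 'b) ell2"
  is "\<lambda>a f i. a *\<^sub>R f i"
  by (simp add: summable_norm2_scaleC flip: scaleC_of_real)
lift_definition norm_ell2 :: "('a, 'b) ell2 \<Rightarrow> real"
  is "\<lambda>f. sqrt (\<Sum>\<^sub>\<infinity>i. (norm (f i))\<^sup>2)" .
lift_definition cinner_ell2 :: "('a, 'b) ell2 \<Rightarrow> ('a, 'b) ell2 \<Rightarrow> complex"
  is "\<lambda>f g. \<Sum>\<^sub>\<infinity>i. cinner (f i) (g i)" .
definition dist_ell2 :: "('a, 'b) ell2 \<Rightarrow> ('a, 'b) ell2 \<Rightarrow> real"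
  where "dist_ell2 f g = norm (f - g)"
definition sgn_ell2 :: "('a, 'b) ell2 \<Rightarrow> ('a, 'b) ell2"
  where "sgn_ell2 f = inverse (norm f) *\<^sub>R f"
definition uniformity_ell2 :: "(('a, 'b) ell2 \<times> ('a, 'b) ell2) filter"
  where "uniformity_ell2 = (INF e\<in>{0<..}. principal {(x, y). dist x y < e})"
definition open_ell2 :: "('a, 'b) ell2 set \<Rightarrow> bool"
  where "open_ell2 U \<longleftrightarrow> (\<forall>x\<in>U. eventually (\<lambda>(x', y). x' = x \<longrightarrow> y \<in> U) uniformity)"

lemma norm_ell2_le_iff:
  fixes f :: "('a, 'b) ell2"
  assumes "B \<ge> 0"
  shows "norm f \<le> B \<longleftrightarrow> (\<forall>F. finite F \<longrightarrow> L2_set (\<lambda>i. norm (coord f i)) F \<le> B)"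
proof -
  have s: "(\<lambda>i. (norm (coord f i))\<^sup>2) summable_on UNIV"
    using coord[of f] by simp
  have sq: "sqrt x \<le> B \<longleftrightarrow> x \<le> B\<^sup>2" for x
    using assms real_le_lsqrt sqrt_le_D by blast
  have "(\<Sum>\<^sub>\<infinity>i. (norm (coord f i))\<^sup>2) \<le> B\<^sup>2 \<longleftrightarrow>
      (\<forall>F. finite F \<longrightarrow> (\<Sum>i\<in>F. (norm (coord f i))\<^sup>2) \<le> B\<^sup>2)"
  proof (intro iffI allI impI)
    fix F :: "'a set"
    assume "(\<Sum>\<^sub>\<infinity>i. (norm (coord f i))\<^sup>2) \<le> B\<^sup>2" "finite F"
    then show "(\<Sum>i\<in>F. (norm (coord f i))\<^sup>2) \<le> B\<^sup>2"
      using finite_sum_le_infsum[OF s, of F] by simp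
  qed (blast intro: infsum_le_finite_sums[OF s])
  then show ?thesis
    unfolding norm_ell2.rep_eq L2_set_def sq .
qed

lemma norm_ell2_nonneg: "norm (f :: ('a, 'b) ell2) \<ge> 0"
  by (simp add: norm_ell2.rep_eq infsum_nonneg)

instance
proof
  fix x y z :: "('a, 'b) ell2" and a b :: real and c d :: complex
  show "x + y + z = x + (y + z)" "x + y = y + x" "0 + x = x" "- x + x = 0" "x - y = x + - y"
    by (transfer; simp add: algebra_simps)+
  show "a *\<^sub>R (x + y) = a *\<^sub>R x + a *\<^sub>R y" "(a + b) *\<^sub>R x = a *\<^sub>R x + b *\<^sub>R x"
    "a *\<^sub>R b *\<^sub>R x = (a * b) *\<^sub>R x" "1 *\<^sub>R x = x"
    by (transfer; simp add: algebra_simps)+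
  show "dist x y = norm (x - y)" "sgn x = inverse (norm x) *\<^sub>R x"
    by (simp_all add: dist_ell2_def sgn_ell2_def)
  show "uniformity = (INF e\<in>{0<..}. principal {(x, y). dist (x :: ('a, 'b) ell2) y < e})"
    by (fact uniformity_ell2_def)
  show "open U \<longleftrightarrow> (\<forall>x\<in>U. \<forall>\<^sub>F (x', y) in uniformity. x' = x \<longrightarrow> y \<in> U)"
    for U :: "('a, 'b) ell2 set"
    by (fact open_ell2_def)
  show "norm x = 0 \<longleftrightarrow> x = 0"
  proof
    assume "norm x = 0"
    then have le: "L2_set (\<lambda>i. norm (coord x i)) F \<le> 0" if "finite F" for F
      using norm_ell2_le_iff[of 0 x] that by simp
    have "coord x i = 0" for i
      using le[of "{i}"] by (simp add: L2_set_def)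
    then show "x = 0" by (simp add: coord_inject[symmetric] zero_ell2.rep_eq fun_eq_iff)
  qed (simp add: norm_ell2.rep_eq zero_ell2.rep_eq)
  show "norm (x + y) \<le> norm x + norm y"
  proof (subst norm_ell2_le_iff, use norm_ell2_nonneg[of x] norm_ell2_nonneg[of y] in simp, intro allI impI)
    fix F :: "'a set" assume F: "finite F"
    have "L2_set (\<lambda>i. norm (coord (x + y) i)) F \<le> L2_set (\<lambda>i. norm (coord x i) + norm (coord y i)) F"
      by (intro L2_set_mono) (auto simp: plus_ell2.rep_eq norm_triangle_ineq)
    also have "\<dots> \<le> L2_set (\<lambda>i. norm (coord x i)) F + L2_set (\<lambda>i. norm (coord y i)) F"
      by (rule L2_set_triangle_ineq)
    also have "\<dots> \<le> norm x + norm y"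
      using norm_ell2_le_iff[OF norm_ell2_nonneg, of x x] norm_ell2_le_iff[OF norm_ell2_nonneg, of y y] F
      by (intro add_mono) auto
    finally show "L2_set (\<lambda>i. norm (coord (x + y) i)) F \<le> norm x + norm y" .
  qed
  show "norm (a *\<^sub>R x) = \<bar>a\<bar> * norm x"
    by (simp add: norm_ell2.rep_eq scaleR_ell2.rep_eq power_mult_distrib infsum_cmult_right' real_sqrt_mult)
  show "c *\<^sub>C (x + y) = c *\<^sub>C x + c *\<^sub>C y" "(c + d) *\<^sub>C x = c *\<^sub>C x + d *\<^sub>C x"
    "c *\<^sub>C d *\<^sub>C x = (c * d) *\<^sub>C x" "complex_of_real a *\<^sub>C x = a *\<^sub>R x"
    by (transfer; simp add: scaleC_add_right scaleC_add_left scaleC_scaleC scaleC_of_real)+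
  show "cinner (x + y) z = cinner x z + cinner y z"
    by transfer (simp add: cinner_add_left infsum_add summable_cinner)
  show "cinner (c *\<^sub>C x) y = c * cinner x y"
    by transfer (simp add: cinner_scaleC_left infsum_cmult_right')
  show "cinner x y = cnj (cinner y x)"
    unfolding cinner_ell2.rep_eq infsum_cnj[symmetric] by (intro infsum_cong) (rule cinner_commute)
  show "cinner x x = complex_of_real ((norm x)\<^sup>2)"
  proof -
    have s: "(\<lambda>i. (norm (coord x i))\<^sup>2) summable_on UNIV" using coord[of x] by simp
    have "cinner x x = (\<Sum>\<^sub>\<infinity>i. (norm (coord x i))\<^sup>2 *\<^sub>R (1::complex))"
      unfolding cinner_ell2.rep_eq by (simp add: cinner_self scaleR_conv_of_real)
    also have "\<dots> = (\<Sum>\<^sub>\<infinity>i. (norm (coord x i))\<^sup>2) *\<^sub>R 1"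
      by (rule infsum_scaleR_left) (rule s)
    also have "\<dots> = complex_of_real ((norm x)\<^sup>2)"
      unfolding norm_ell2.rep_eq
      by (simp add: infsum_nonneg scaleR_conv_of_real del: of_real_power)
    finally show ?thesis .
  qed
qed

end

instance ell2 :: (type, chilbert_space) chilbert_space
proof
  fix X :: "nat \<Rightarrow> ('a, 'b) ell2"
  assume X: "Cauchy X"
  have L2: "L2_set (\<lambda>i. norm (coord f i)) F \<le> norm f" if "finite F" for f :: "('a, 'b) ell2" and F
    using norm_ell2_le_iff[of "norm f" f] that by simp
  have le: "norm (coord f i) \<le> norm f" for f :: "('a, 'b) ell2" and i
    using L2[of "{i}" f] by (simp add: L2_set_def)
  have "Cauchy (\<lambda>m. coord (X m) i)" for i
  proof (rule CauchyI)
    fix e :: real assume "e > 0"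
    then obtain M where M: "\<forall>m\<ge>M. \<forall>k\<ge>M. norm (X m - X k) < e" using CauchyD[OF X] by blast
    have "norm (coord (X m) i - coord (X k) i) < e" if "m \<ge> M" "k \<ge> M" for m k
    proof -
      have "norm (coord (X m) i - coord (X k) i) \<le> norm (X m - X k)"
        using le[of "X m - X k" i] by (simp add: minus_ell2.rep_eq)
      then show ?thesis using M that by (meson le_less_trans)
    qed
    then show "\<exists>M. \<forall>m\<ge>M. \<forall>k\<ge>M. norm (coord (X m) i - coord (X k) i) < e" by blast
  qed
  then have "\<forall>i. \<exists>l. (\<lambda>m. coord (X m) i) \<longlonglongrightarrow> l"
    by (simp add: Cauchy_convergent_iff convergent_def)
  from choice[OF this] obtain g where g: "\<And>i. (\<lambda>m. coord (X m) i) \<longlonglongrightarrow> g i" by blast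
  have lim: "L2_set (\<lambda>i. norm (coord (X m) i - g i)) F \<le> e"
    if F: "finite F" and M: "\<And>k. k \<ge> M \<Longrightarrow> norm (X m - X k) < e" for m M e F
  proof (rule LIMSEQ_le_const2)
    show "(\<lambda>k. L2_set (\<lambda>i. norm (coord (X m) i - coord (X k) i)) F)
        \<longlonglongrightarrow> L2_set (\<lambda>i. norm (coord (X m) i - g i)) F"
      unfolding L2_set_def by (intro tendsto_intros g)
    have "L2_set (\<lambda>i. norm (coord (X m) i - coord (X k) i)) F \<le> e" if "k \<ge> M" for k
      using L2[OF F, of "X m - X k"] M[OF that] by (simp add: minus_ell2.rep_eq)
    then show "\<exists>N. \<forall>k\<ge>N. L2_set (\<lambda>i. norm (coord (X m) i - coord (X k) i)) F \<le> e" by blast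
  qed
  obtain M1 where M1: "\<forall>m\<ge>M1. \<forall>k\<ge>M1. norm (X m - X k) < 1" using CauchyD[OF X, of 1] by auto
  have "L2_set (\<lambda>i. norm (g i - coord (X M1) i)) F \<le> 1" if "finite F" for F
    using lim[OF that, of M1 M1 1] M1 by (simp add: norm_minus_commute)
  then have "(\<lambda>i. (norm (g i - coord (X M1) i))\<^sup>2) summable_on UNIV"
    unfolding ell2_iff_bounded by blast
  from summable_norm2_add[OF this, of "coord (X M1)"]
  have gs: "(\<lambda>i. (norm (g i))\<^sup>2) summable_on UNIV" using coord[of "X M1"] by simp
  define G where "G = Abs_ell2 g"
  have G: "coord G = g" using gs by (simp add: G_def Abs_ell2_inverse)
  have "X \<longlonglongrightarrow> G"
  proof (rule LIMSEQ_I)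
    fix r :: real assume r: "r > 0"
    then obtain M where M: "\<forall>m\<ge>M. \<forall>k\<ge>M. norm (X m - X k) < r / 2"
      using CauchyD[OF X, of "r/2"] by auto
    have "norm (X m - G) < r" if m: "m \<ge> M" for m
    proof -
      have "L2_set (\<lambda>i. norm (coord (X m - G) i)) F \<le> r / 2" if "finite F" for F
        using lim[OF that, of M m "r/2"] M m by (simp add: minus_ell2.rep_eq G)
      then have "norm (X m - G) \<le> r / 2"
        using r norm_ell2_le_iff[of "r / 2" "X m - G"] by simp
      then show ?thesis using r by simp
    qed
    then show "\<exists>no. \<forall>n\<ge>no. norm (X n - G) < r" by blast
  qed
  then show "convergent X" by (auto simp: convergent_def)
qed

section \<open>Words and the full Fock space\<close>

text \<open>
  The letters are the numbers 1 to n with \<^term>\<open>n = CARD('n)\<close>; as types are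
  nonempty, \<^term>\<open>n \<ge> (1::nat)\<close> holds. The free monoid of words is the type of lists of letters.
\<close>

typedef ('n::finite) letter = "{1..CARD('n)}"
  by (intro exI[of _ 1]) (simp add: Suc_leI)

type_synonym 'n word = "'n letter list"

definition first_letter :: "'n::finite letter" where "first_letter = Abs_letter 1"
definition last_letter :: "'n::finite letter" where "last_letter = Abs_letter CARD('n)"

text \<open>The next two are only meaningful for letters other than the last, respectively the first, one.\<close>

definition next_letter :: "'n::finite letter \<Rightarrow> 'n letter"
  where "next_letter j = Abs_letter (Rep_letter j + 1)"
definition prev_letter :: "'n::finite letter \<Rightarrow> 'n letter"
  where "prev_letter j = Abs_letter (Rep_letter j - 1)"

text \<open>
  An element of the k-th tensor power of \<open>\<complex>\<^sup>n\<close> is a family of scalars indexed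
  by the words of length k, so the Hilbert space direct sum of all tensor powers consists of the
  square-summable families of scalars indexed by all words. In the same way, the Hilbert
  space tensor product of the Fock space with a Hilbert space \<open>E\<close> consists of the square-summable
  families of vectors of \<open>E\<close>; see \<open>cinner_tensor\<close> and \<open>span_tensor_dense\<close> below.
\<close>

type_synonym 'n fock = "('n word, complex) ell2"
type_synonym ('n, 'e) fock_tensor = "('n word, 'e) ell2"

lift_definition tensor :: "('i, complex) ell2 \<Rightarrow> 'e::complex_inner \<Rightarrow> ('i, 'e) ell2"  (infixr "\<otimes>" 76)
  is "\<lambda>f \<eta> i. f i *\<^sub>C \<eta>"
  by (simp add: norm_scaleC power_mult_distrib summable_on_cmult_left)

lift_definition basis_vec :: "'i \<Rightarrow> ('i, complex) ell2"
  is "\<lambda>i j. if j = i then 1 else 0"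
proof -
  fix i :: 'i
  have "(\<lambda>j. (norm (if j = i then 1 else 0 :: complex))\<^sup>2) summable_on UNIV \<longleftrightarrow>
      (\<lambda>j. (norm (if j = i then 1 else 0 :: complex))\<^sup>2) summable_on {i}"
    by (rule summable_on_cong_neutral) auto
  then show "(\<lambda>j. (norm (if j = i then 1 else 0 :: complex))\<^sup>2) summable_on UNIV" by simp
qed

abbreviation e_word :: "'n::finite word \<Rightarrow> 'n fock"  ("e[_]") where "e[\<mu>] \<equiv> basis_vec \<mu>"

abbreviation (input) vacuum :: "'n::finite fock"  ("\<Omega>") where "\<Omega> \<equiv> basis_vec []"

text \<open>\<open>left_tensor \<nu> f\<close> is \<open>e\<^sub>\<nu> \<otimes> f\<close>; see \<open>left_tensor_tensor\<close> below.\<close>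

lift_definition left_tensor :: "'n::finite word \<Rightarrow> ('n, 'e::complex_inner) fock_tensor \<Rightarrow> ('n, 'e) fock_tensor"
  is "\<lambda>\<nu> f w. if take (length \<nu>) w = \<nu> then f (drop (length \<nu>) w) else 0"
proof -
  fix \<nu> :: "'n word" and f :: "'n word \<Rightarrow> 'e"
  let ?g = "\<lambda>w. (norm (if take (length \<nu>) w = \<nu> then f (drop (length \<nu>) w) else 0))\<^sup>2"
  assume f: "(\<lambda>i. (norm (f i))\<^sup>2) summable_on UNIV"
  have "?g summable_on range ((@) \<nu>) \<longleftrightarrow> (?g \<circ> (@) \<nu>) summable_on UNIV"
    by (rule summable_on_reindex) (simp add: inj_on_def)
  then have "?g summable_on range ((@) \<nu>)" using f by (simp add: o_def)
  moreover have "?g summable_on UNIV \<longleftrightarrow> ?g summable_on range ((@) \<nu>)"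
    by (rule summable_on_cong_neutral) (auto, metis append_take_drop_id rangeI)
  ultimately show "?g summable_on UNIV" by simp
qed

lemma left_tensor_tensor: "left_tensor \<nu> (e[\<mu>] \<otimes> \<eta>) = e[\<nu> @ \<mu>] \<otimes> \<eta>"
  by transfer (auto simp: fun_eq_iff, metis append_take_drop_id)

lemma cinner_tensor: "cinner (f \<otimes> x) (g \<otimes> y) = cinner f g * cinner x y"
proof -
  have "cinner (coord f i *\<^sub>C x) (coord g i *\<^sub>C y) = cinner (coord f i) (coord g i) * cinner x y" for i
    by (simp add: cinner_scaleC_left cinner_scaleC_right cinner_complex_def)
  then show ?thesis
    unfolding cinner_ell2.rep_eq tensor.rep_eq by (simp only: infsum_cmult_left')
qed

lemma coord_sum: "coord (\<Sum>j\<in>F. x j) i = (\<Sum>j\<in>F. coord (x j) i)"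
  by (induction F rule: infinite_finite_induct) (auto simp: zero_ell2.rep_eq plus_ell2.rep_eq)

lemma basis_tensor_dense:
  fixes f :: "('i, 'e::complex_inner) ell2"
  shows "f \<in> closure (complex_vector.span {basis_vec i \<otimes> \<eta> | i \<eta>. True})"
  unfolding closure_approachable
proof (intro allI impI)
  fix r :: real assume r: "r > 0"
  have s: "(\<lambda>i. (norm (coord f i))\<^sup>2) summable_on UNIV" using coord[of f] by simp
  obtain F where F: "finite F" and
    d: "dist (\<Sum>i\<in>F. (norm (coord f i))\<^sup>2) (\<Sum>\<^sub>\<infinity>i. (norm (coord f i))\<^sup>2) \<le> r\<^sup>2 / 4"
    using infsum_finite_approximation[OF s, of "r\<^sup>2 / 4"] r by auto
  define g where "g = (\<Sum>i\<in>F. basis_vec i \<otimes> coord f i)"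
  have "coord g i = (\<Sum>j\<in>F. if i = j then coord f j else 0)" for i
    by (auto simp: g_def coord_sum tensor.rep_eq basis_vec.rep_eq intro!: sum.cong)
  then have g: "coord g i = (if i \<in> F then coord f i else 0)" for i
    using F by simp
  have "(norm (f - g))\<^sup>2 = (\<Sum>\<^sub>\<infinity>i. (norm (coord f i - coord g i))\<^sup>2)"
    by (simp add: norm_ell2.rep_eq minus_ell2.rep_eq infsum_nonneg)
  also have "\<dots> = (\<Sum>\<^sub>\<infinity>i\<in>UNIV - F. (norm (coord f i))\<^sup>2)"
    by (rule infsum_cong_neutral) (auto simp: g)
  also have "\<dots> = (\<Sum>\<^sub>\<infinity>i. (norm (coord f i))\<^sup>2) - (\<Sum>\<^sub>\<infinity>i\<in>F. (norm (coord f i))\<^sup>2)"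
    using s F by (intro infsum_Diff) auto
  also have "\<dots> \<le> r\<^sup>2 / 4" using d F unfolding dist_real_def infsum_finite[OF F] by linarith
  finally have "(norm (f - g))\<^sup>2 \<le> (r / 2)\<^sup>2" by (simp add: power_divide)
  then have "norm (f - g) \<le> r / 2" by (rule power2_le_imp_le) (use r in simp)
  then have "dist g f < r" using r by (simp add: dist_norm norm_minus_commute[of g f])
  moreover have "g \<in> complex_vector.span {basis_vec i \<otimes> \<eta> | i \<eta>. True}"
    unfolding g_def
  proof (rule complex_vector.span_sum)
    show "basis_vec i \<otimes> coord f i \<in> complex_vector.span {basis_vec i \<otimes> \<eta> | i \<eta>. True}" for i
      by (rule complex_vector.span_base) auto
  qed
  ultimately show "\<exists>y\<in>complex_vector.span {basis_vec i \<otimes> \<eta> | i \<eta>. True}. dist y f < r" by (rule bexI)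
qed

lemma span_tensor_dense:
  "closure (complex_vector.span {f \<otimes> \<eta> | (f :: 'n::finite fock) (\<eta> :: 'e::complex_inner). True}) = UNIV"
proof -
  have "complex_vector.span {basis_vec \<mu> \<otimes> \<eta> | (\<mu> :: 'n word) (\<eta> :: 'e). True}
      \<subseteq> complex_vector.span {f \<otimes> \<eta> | (f :: 'n fock) \<eta>. True}"
    by (rule complex_vector.span_mono) blast
  from closure_mono[OF this] show ?thesis using basis_tensor_dense by blast
qed

lemma orthonormal_basis_e_word: "orthonormal_basis UNIV (e_word :: 'n::finite word \<Rightarrow> 'n fock)"
  unfolding orthonormal_basis_def
proof (intro conjI ballI)
  fix \<mu> \<nu> :: "'n word"
  have "cinner e[\<mu>] e[\<nu>] = (\<Sum>\<^sub>\<infinity>w\<in>{\<mu>}. if \<mu> = \<nu> then 1 else 0 :: complex)"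
    unfolding cinner_ell2.rep_eq basis_vec.rep_eq cinner_complex_def
    by (rule infsum_cong_neutral) auto
  then show "cinner e[\<mu>] e[\<nu>] = (if \<mu> = \<nu> then 1 else 0)" by simp
next
  have "basis_vec i \<otimes> \<eta> = \<eta> *\<^sub>C basis_vec i" for i :: "'n word" and \<eta> :: complex
    by transfer (simp add: scaleC_complex_def mult.commute)
  then have "{basis_vec i \<otimes> \<eta> | (i :: 'n word) (\<eta> :: complex). True} \<subseteq> complex_vector.span (range e_word)"
    by (auto intro: complex_vector.span_scale complex_vector.span_base)
  then have "complex_vector.span {basis_vec i \<otimes> \<eta> | (i :: 'n word) (\<eta> :: complex). True}
      \<subseteq> complex_vector.span (range e_word)"
    by (intro complex_vector.span_minimal complex_vector.subspace_span)
  from closure_mono[OF this]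
  show "closure (complex_vector.span (range (e_word :: 'n word \<Rightarrow> 'n fock))) = UNIV"
    using basis_tensor_dense by blast
qed

section \<open>Odometer maps\<close>

definition leading :: "'n::finite letter \<Rightarrow> 'n word \<Rightarrow> nat"
  where "leading a \<mu> = length (takeWhile (\<lambda>j. j = a) \<mu>)"

text \<open>
  If \<open>k\<close> is the smallest 1-based index with \<open>\<mu>\<^sub>k \<noteq> a\<close>, then \<open>leading a \<mu> = k - 1\<close> is the
  0-based position of that letter. The successor word is used only for words with some
  letter other than \<open>n\<close>.
\<close>

definition word_succ :: "'n::finite word \<Rightarrow> 'n word"
  where "word_succ \<mu> = (let i = leading last_letter \<mu> in
    replicate i first_letter @ next_letter (\<mu> ! i) # drop (Suc i) \<mu>)"

definition odometer_map ::
    "('e::chilbert_space \<Rightarrow> ('n::finite, 'e) fock_tensor) \<Rightarrow>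
     (('n, 'e) fock_tensor \<Rightarrow> ('n, 'e) fock_tensor) \<Rightarrow> bool"
  where "odometer_map L W \<longleftrightarrow>
    (\<forall>\<eta>. W (\<Omega> \<otimes> \<eta>) = L \<eta>) \<and>
    (\<forall>m\<ge>1. \<forall>\<eta>. W (e[replicate m last_letter] \<otimes> \<eta>) = left_tensor (replicate m first_letter) (L \<eta>)) \<and>
    (\<forall>\<mu> \<eta>. (\<exists>j\<in>set \<mu>. j \<noteq> last_letter) \<longrightarrow> W (e[\<mu>] \<otimes> \<eta>) = e[word_succ \<mu>] \<otimes> \<eta>)"

definition M0 :: "'n::finite word set"
  where "M0 = {\<mu>. length \<mu> \<ge> 1 \<and> (\<exists>j\<in>set \<mu>. j \<noteq> first_letter)}"

definition word_pred :: "'n::finite word \<Rightarrow> 'n word"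
  where "word_pred \<gamma> = (let i = leading first_letter \<gamma> in
    replicate i last_letter @ prev_letter (\<gamma> ! i) # drop (Suc i) \<gamma>)"

definition odometer_coeff ::
    "('e::chilbert_space \<Rightarrow> ('n::finite, 'e) fock_tensor) \<Rightarrow> ('l \<Rightarrow> 'e) \<Rightarrow> 'l \<Rightarrow> 'n word \<Rightarrow> 'l \<Rightarrow> complex"
  where "odometer_coeff L h q \<mu> s = cinner (L (h q)) (e[\<mu>] \<otimes> h s)"

end

theory Submission
  imports Defs
begin

text \<open>
  Adjoints are obtained from an orthonormal basis: by Bessel's inequality the series
  \<open>\<Sum>\<^sub>i cnj (f b\<^sub>i) b\<^sub>i\<close> converges unconditionally for every bounded functional \<open>f\<close>, and its sum
  represents \<open>f\<close>. For \<open>f x = \<langle>L x, y\<rangle>\<close> this is the expansion of \<open>L\<^sup>* y\<close>, so the two formulas for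
  \<open>W\<^sup>*\<close> agree. The second one is checked by pairing with \<open>e\<^sub>\<mu> \<otimes> \<eta>\<close>. If \<open>\<mu> = n\<^sup>m\<close>, then
  \<open>\<langle>e\<^sub>1\<^sup>m \<otimes> L \<eta>, e\<^sub>\<gamma> \<otimes> h\<rangle>\<close> is nonzero only if \<open>\<gamma>\<close> begins with \<open>m\<close> letters 1, and it is then the
  pairing with the summand \<open>p = m\<close>. For all other \<open>\<mu>\<close>, the map \<open>\<mu> \<mapsto> \<mu> + 1\<close> is a bijection onto
  \<open>M\<^sub>0\<close> with inverse \<open>\<gamma> \<mapsto> \<gamma> - 1\<close>.
\<close>

section \<open>Additivity, separation and continuity of the inner product\<close>

lemma cinner_zero_left [simp]: "cinner 0 x = 0" for x :: "'a::complex_inner"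
  using cinner_add_left[of 0 0 x] by simp

lemma cinner_zero_right [simp]: "cinner x 0 = 0" for x :: "'a::complex_inner"
  using cinner_add_right[of x 0 0] by simp

lemma cinner_sum_right: "cinner x (\<Sum>i\<in>F. g i) = (\<Sum>i\<in>F. cinner x (g i))"
  for x :: "'a::complex_inner"
  by (induction F rule: infinite_finite_induct) (simp_all add: cinner_add_right)

lemma cinner_sum_left: "cinner (\<Sum>i\<in>F. g i) x = (\<Sum>i\<in>F. cinner (g i) x)"
  for x :: "'a::complex_inner"
  by (induction F rule: infinite_finite_induct) (simp_all add: cinner_add_left)

lemma cinner_diff_right: "cinner x (y - z) = cinner x y - cinner x z"
  for x :: "'a::complex_inner"
  using cinner_add_right[of x "y - z" z] by simp

lemma cinner_scaleR_left: "cinner (r *\<^sub>R x) y = r *\<^sub>R cinner x y"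
  for x :: "'a::complex_inner"
  by (simp add: cinner_scaleC_left scaleR_conv_of_real flip: scaleC_of_real)

lemma cinner_eqI: "(\<And>x. cinner x y = cinner x z) \<Longrightarrow> y = z" for y z :: "'a::complex_inner"
  using cinner_self[of "y - z"] by (simp add: cinner_diff_right)

text \<open>Only continuity of \<open>cinner\<close> is needed, so the bound from \<open>cinner_bound\<close>, applied to \<open>sgn x\<close>,
  can replace the Cauchy-Schwarz inequality.\<close>

lemma bounded_linear_cinner_left: "bounded_linear (\<lambda>x. cinner x y)"
  for y :: "'a::complex_inner"
proof (rule bounded_linear_intro)
  fix x :: 'a
  show "norm (cinner x y) \<le> norm x * (1 + (norm y)\<^sup>2)"
  proof (cases "x = 0")
    case False
    have "cmod (cinner x y) = cmod (cinner (norm x *\<^sub>R sgn x) y)"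
      using False by (simp add: sgn_div_norm)
    also have "\<dots> = norm x * cmod (cinner (sgn x) y)"
      by (simp add: cinner_scaleR_left)
    also have "\<dots> \<le> norm x * ((norm (sgn x))\<^sup>2 + (norm y)\<^sup>2)"
      by (intro mult_left_mono cinner_bound) simp
    finally show ?thesis using False by (simp add: norm_sgn)
  qed simp
qed (simp_all add: cinner_add_left cinner_scaleR_left)

lemma bounded_linear_cinner_right: "bounded_linear (cinner x)"
  for x :: "'a::complex_inner"
proof -
  have "bounded_linear (\<lambda>y. cnj (cinner y x))"
    by (rule bounded_linear_compose[OF bounded_linear_cnj bounded_linear_cinner_left])
  then show ?thesis by (simp flip: cinner_commute)
qed

section \<open>Unconditional convergence, Riesz representation and adjoints\<close>

lemma summable_on_if_norm_sum_le:
  fixes f :: "'i \<Rightarrow> 'a::chilbert_space" and a :: "'i \<Rightarrow> real"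
  assumes le: "\<And>F. finite F \<Longrightarrow> F \<subseteq> A \<Longrightarrow> (norm (sum f F))\<^sup>2 \<le> sum a F"
    and a: "a summable_on A" and nonneg: "\<And>i. i \<in> A \<Longrightarrow> a i \<ge> 0"
  shows "f summable_on A"
proof -
  have "\<exists>P. eventually P (finite_subsets_at_top A) \<and>
      (\<forall>F G. P F \<and> P G \<longrightarrow> dist (sum f F) (sum f G) < e)" if e: "e > 0" for e
  proof -
    \<comment> \<open>Once the tail of \<open>a\<close> beyond \<open>F0\<close> is at most
      \<open>(e / 3)\<^sup>2\<close>, the bound \<open>le\<close> on \<open>F - F0\<close> puts
      \<open>sum f F\<close> within \<open>e / 3\<close> of \<open>sum f F0\<close>. Two such
      distances add up to strictly less than \<open>e\<close>.\<close>
    obtain F0 where F0: "finite F0" "F0 \<subseteq> A" and d: "dist (sum a F0) (infsum a A) \<le> (e / 3)\<^sup>2"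
      using infsum_finite_approximation[OF a, of "(e / 3)\<^sup>2"] e by auto
    define P where "P F \<longleftrightarrow> finite F \<and> F0 \<subseteq> F \<and> F \<subseteq> A" for F
    have diff: "norm (sum f F - sum f F0) \<le> e / 3" if "P F" for F
    proof -
      have F: "finite F" "F0 \<subseteq> F" "F \<subseteq> A" using that by (auto simp: P_def)
      have "(norm (sum f F - sum f F0))\<^sup>2 = (norm (sum f (F - F0)))\<^sup>2"
        using F by (simp add: sum_diff)
      also have "\<dots> \<le> sum a (F - F0)" using F by (intro le) auto
      also have "\<dots> = sum a F - sum a F0" using F by (simp add: sum_diff)
      also have "\<dots> \<le> infsum a A - sum a F0"
        using finite_sum_le_infsum[OF a F(1,3)] nonneg by simp
      also have "\<dots> \<le> (e / 3)\<^sup>2" using d by (simp add: dist_real_def)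
      finally show ?thesis by (rule power2_le_imp_le) (use e in simp)
    qed
    have "dist (sum f F) (sum f G) < e" if "P F" "P G" for F G
    proof -
      have "dist (sum f F) (sum f G) \<le> dist (sum f F) (sum f F0) + dist (sum f G) (sum f F0)"
        by (rule dist_triangle2)
      also have "\<dots> \<le> e / 3 + e / 3"
        unfolding dist_norm by (intro add_mono diff that)
      finally show ?thesis using e by simp
    qed
    moreover have "eventually P (finite_subsets_at_top A)"
      unfolding eventually_finite_subsets_at_top P_def using F0 by blast
    ultimately show ?thesis by blast
  qed
  \<comment> \<open>The partial sums are indexed by the finite subsets of \<open>A\<close>, so the
    limit comes from completeness for Cauchy filters instead of Cauchy sequences.\<close>
  then have "cauchy_filter (filtermap (sum f) (finite_subsets_at_top A))"
    by (simp add: cauchy_filter_metric_filtermap)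
  moreover have "complete (UNIV :: 'a set)"
    by (meson Cauchy_convergent UNIV_I complete_def convergent_def)
  ultimately obtain s where "(sum f \<longlongrightarrow> s) (finite_subsets_at_top A)"
    using complete_uniform[where S = "UNIV :: 'a set"] by (force simp: filterlim_def)
  then show ?thesis
    using summable_on_def has_sum_def by blast
qed

text \<open>Agreement of \<open>f\<close> with the pairing against the limit \<open>y\<close> is
  checked on basis vectors; linearity carries it to their span and continuity to its closure, the
  whole space.\<close>

lemma riesz_expansion:
  fixes f :: "'a::chilbert_space \<Rightarrow> complex"
  assumes f: "bounded_linear f" and fC: "\<And>a x. f (a *\<^sub>C x) = a * f x"
    and b: "orthonormal_basis I b"
  obtains y where "((\<lambda>i. cnj (f (b i)) *\<^sub>C b i) has_sum y) I" "\<And>x. f x = cinner x y"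
proof -
  interpret f: bounded_linear f by (rule f)
  let ?v = "\<lambda>i. cnj (f (b i)) *\<^sub>C b i"
  let ?a = "\<lambda>i. (cmod (f (b i)))\<^sup>2"
  have orth: "cinner (b i) (b j) = (if i = j then 1 else 0)" if "i \<in> I" "j \<in> I" for i j
    using b that by (simp add: orthonormal_basis_def)
  have norm_sum: "(norm (sum ?v F))\<^sup>2 = sum ?a F" if "finite F" "F \<subseteq> I" for F
  proof -
    have "complex_of_real ((norm (sum ?v F))\<^sup>2) = (\<Sum>i\<in>F. \<Sum>j\<in>F. cinner (?v j) (?v i))"
      unfolding cinner_self[symmetric] by (simp only: cinner_sum_left cinner_sum_right)
    also have "\<dots> = (\<Sum>i\<in>F. \<Sum>j\<in>F. if i = j then complex_of_real (?a i) else 0)"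
      using that orth
      by (intro sum.cong refl)
        (auto simp: subset_iff cinner_scaleC_left cinner_scaleC_right complex_norm_square mult.commute
          simp del: of_real_power)
    also have "\<dots> = complex_of_real (sum ?a F)"
      using that by simp
    finally show ?thesis unfolding of_real_eq_iff .
  qed
  obtain K where K: "\<And>x. cmod (f x) \<le> norm x * K" "K \<ge> 0"
    using f.nonneg_bounded by blast
  \<comment> \<open>Test \<open>f\<close> on the partial sum \<open>s = sum ?v F\<close> itself:
    \<open>f s\<close> equals the squared norm of \<open>s\<close> and is at most
    \<open>norm s * K\<close>, so cancelling \<open>norm s\<close> gives
    \<open>norm s \<le> K\<close>.\<close>
  have bessel: "sum ?a F \<le> K\<^sup>2" if "finite F" "F \<subseteq> I" for F
  proof -
    have "f (sum ?v F) = complex_of_real (sum ?a F)"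
      by (simp add: f.sum fC complex_norm_square mult.commute del: of_real_power)
    then have "sum ?a F = cmod (f (sum ?v F))"
      by (simp add: sum_nonneg del: of_real_sum)
    also have "\<dots> \<le> norm (sum ?v F) * K" by (rule K)
    finally have "norm (sum ?v F) * norm (sum ?v F) \<le> norm (sum ?v F) * K"
      using norm_sum[OF that] by (simp add: power2_eq_square)
    then have "norm (sum ?v F) \<le> K"
      using K(2) by (cases "norm (sum ?v F) = 0") (auto simp: mult_le_cancel_left)
    then show ?thesis
      unfolding norm_sum[OF that, symmetric] by (simp add: power_mono)
  qed
  have "?a summable_on I"
    by (intro nonneg_bdd_above_summable_on bdd_aboveI2[where M = "K\<^sup>2"]) (auto simp: bessel)
  then have "?v summable_on I"
    by (rule summable_on_if_norm_sum_le[rotated]) (simp_all add: norm_sum)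
  then obtain y where y: "(?v has_sum y) I" by (auto simp: summable_on_def)
  have basis: "f (b j) = cinner (b j) y" if j: "j \<in> I" for j
  proof -
    have "((\<lambda>i. cinner (b j) (?v i)) has_sum cinner (b j) y) I"
      using has_sum_bounded_linear[OF bounded_linear_cinner_right y] by (simp add: o_def)
    \<comment> \<open>Only \<open>i = j\<close> survives by orthogonality, and conjugate linearity
      in the second argument undoes the \<open>cnj\<close> in \<open>?v\<close>.\<close>
    also have "?this \<longleftrightarrow> ((\<lambda>i. f (b j)) has_sum cinner (b j) y) {j}"
      using j by (intro has_sum_cong_neutral) (auto simp: orth cinner_scaleC_right)
    finally show ?thesis
      using has_sum_finite[of "{j}" "\<lambda>i. f (b j)"] has_sum_unique by fastforce
  qed
  have "f x = cinner x y" for x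
  proof -
    let ?S = "{x. f x = cinner x y}"
    have "complex_vector.span (b ` I) \<subseteq> ?S"
      by (rule complex_vector.span_minimal)
        (auto simp: complex_vector.subspace_def basis f.zero f.add fC cinner_add_left
          cinner_scaleC_left)
    moreover have "closed ?S"
      by (intro closed_Collect_eq linear_continuous_on f bounded_linear_cinner_left)
    ultimately show ?thesis
      using b closure_minimal[of "complex_vector.span (b ` I)" ?S]
      by (auto simp: orthonormal_basis_def)
  qed
  with y show thesis by (rule that)
qed

text \<open>As \<open>cadjoint\<close> is a definite description, both existence and uniqueness are
  required. \<open>riesz_expansion\<close>, applied for each \<open>y\<close>, gives existence
  together with the series; \<open>cinner_eqI\<close> gives uniqueness.\<close>

lemma cadjoint_expansion:
  fixes T :: "'a::chilbert_space \<Rightarrow> 'b::chilbert_space"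
  assumes T: "bounded_clinear T" and b: "orthonormal_basis I b"
  shows cinner_cadjoint: "cinner (T x) y = cinner x (cadjoint T y)"
    and has_sum_cadjoint: "((\<lambda>i. cnj (cinner (T (b i)) y) *\<^sub>C b i) has_sum cadjoint T y) I"
proof -
  have "\<forall>y. \<exists>z. ((\<lambda>i. cnj (cinner (T (b i)) y) *\<^sub>C b i) has_sum z) I \<and>
      (\<forall>x. cinner (T x) y = cinner x z)"
  proof
    fix y
    have "bounded_linear (\<lambda>x. cinner (T x) y)"
      using bounded_linear_compose[OF bounded_linear_cinner_left] T
      by (auto simp: bounded_clinear_def)
    moreover have "cinner (T (a *\<^sub>C x)) y = a * cinner (T x) y" for a x
      using T by (simp add: bounded_clinear_def cinner_scaleC_left)
    ultimately obtain z where "((\<lambda>i. cnj (cinner (T (b i)) y) *\<^sub>C b i) has_sum z) I"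
      "\<And>x. cinner (T x) y = cinner x z"
      using riesz_expansion[of "\<lambda>x. cinner (T x) y", OF _ _ b] by blast
    then show "\<exists>z. ((\<lambda>i. cnj (cinner (T (b i)) y) *\<^sub>C b i) has_sum z) I \<and>
        (\<forall>x. cinner (T x) y = cinner x z)" by blast
  qed
  from choice[OF this]
  obtain S where S: "\<And>y. ((\<lambda>i. cnj (cinner (T (b i)) y) *\<^sub>C b i) has_sum S y) I"
    "\<And>x y. cinner (T x) y = cinner x (S y)"
    by blast
  have "cadjoint T = S"
    unfolding cadjoint_def
  proof (rule the_equality)
    show "R = S" if "\<forall>x y. cinner (T x) y = cinner x (R y)" for R
      by (rule ext, rule cinner_eqI) (simp flip: S(2) that[rule_format])
  qed (simp add: S)
  then show "cinner (T x) y = cinner x (cadjoint T y)"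
    "((\<lambda>i. cnj (cinner (T (b i)) y) *\<^sub>C b i) has_sum cadjoint T y) I"
    using S by simp_all
qed

section \<open>Elementary tensors and the product basis\<close>

lemma cinner_basis_tensor: "cinner (basis_vec i \<otimes> \<eta>) z = cinner \<eta> (coord z i)"
proof -
  have "cinner (basis_vec i \<otimes> \<eta>) z = (\<Sum>\<^sub>\<infinity>j\<in>{i}. cinner \<eta> (coord z j))"
    unfolding cinner_ell2.rep_eq tensor.rep_eq basis_vec.rep_eq
    by (rule infsum_cong_neutral) auto
  then show ?thesis by simp
qed

lemma cinner_basis_tensor_right: "cinner z (basis_vec i \<otimes> \<eta>) = cinner (coord z i) \<eta>"
  by (subst cinner_commute) (simp add: cinner_basis_tensor flip: cinner_commute)

lemma cinner_basis_tensor_basis_tensor: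
  "cinner (basis_vec i \<otimes> x) (basis_vec j \<otimes> y) = (if i = j then cinner x y else 0)"
  by (simp add: cinner_basis_tensor tensor.rep_eq basis_vec.rep_eq)

text \<open>Such a pairing reads off coordinate \<open>i\<close> against \<open>\<eta>\<close>, and
  varying \<open>\<eta>\<close> determines that coordinate.\<close>

lemma ell2_eqI:
  assumes "\<And>i \<eta>. cinner (basis_vec i \<otimes> \<eta>) y = cinner (basis_vec i \<otimes> \<eta>) z"
  shows "y = z"
proof -
  have "coord y i = coord z i" for i
    by (rule cinner_eqI) (use assms in \<open>simp add: cinner_basis_tensor\<close>)
  then show ?thesis by (simp add: coord_inject[symmetric] fun_eq_iff)
qed

lemma tensor_add_right: "f \<otimes> (x + y) = f \<otimes> x + f \<otimes> y"
  by transfer (simp add: scaleC_add_right)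

lemma tensor_scaleC_right: "f \<otimes> (a *\<^sub>C x) = a *\<^sub>C (f \<otimes> x)"
  by transfer (simp add: scaleC_scaleC mult.commute)

lemma norm_tensor: "norm (f \<otimes> x) = norm f * norm x"
proof -
  have "complex_of_real ((norm (f \<otimes> x))\<^sup>2) = complex_of_real ((norm f * norm x)\<^sup>2)"
    unfolding cinner_self[symmetric] cinner_tensor by (simp add: cinner_self power_mult_distrib)
  then have "(norm (f \<otimes> x))\<^sup>2 = (norm f * norm x)\<^sup>2"
    unfolding of_real_eq_iff .
  then show ?thesis by (simp add: power2_eq_iff_nonneg)
qed

text \<open>This continuity lets tensoring pass through closures and through the basis series of the
  adjoint of \<open>L\<close>.\<close>

lemma bounded_linear_tensor: "bounded_linear (\<lambda>x. f \<otimes> x)"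
proof (rule bounded_linear_intro[where K = "norm f"])
  show "f \<otimes> (r *\<^sub>R x) = r *\<^sub>R (f \<otimes> x)" for r x
    by (simp add: tensor_scaleC_right flip: scaleC_of_real)
qed (simp_all add: tensor_add_right norm_tensor mult.commute)

text \<open>Supplies the basis from which the adjoint of \<open>W\<close> is obtained. For density,
  the span of \<open>h\<close> is first enlarged to all of the second factor with
  \<open>basis_vec i\<close> fixed; then \<open>basis_tensor_dense\<close> applies.\<close>

lemma orthonormal_basis_tensor:
  fixes h :: "'l \<Rightarrow> 'e::chilbert_space"
  assumes h: "orthonormal_basis \<Lambda> h"
  shows "orthonormal_basis (UNIV \<times> \<Lambda>) (\<lambda>(i, q). basis_vec i \<otimes> h q :: ('i, 'e) ell2)"
  unfolding orthonormal_basis_def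
proof (intro conjI ballI)
  let ?b = "\<lambda>(i :: 'i, q). basis_vec i \<otimes> h q"
  fix u v :: "'i \<times> 'l"
  assume "u \<in> UNIV \<times> \<Lambda>" "v \<in> UNIV \<times> \<Lambda>"
  then show "cinner (?b u) (?b v) = (if u = v then 1 else 0)"
    using h
    by (cases u; cases v) (simp add: cinner_basis_tensor_basis_tensor orthonormal_basis_def)
next
  let ?V = "complex_vector.span ((\<lambda>(i, q). basis_vec i \<otimes> h q :: ('i, 'e) ell2) ` (UNIV \<times> \<Lambda>))"
  have "basis_vec i \<otimes> \<eta> \<in> closure ?V" for i :: 'i and \<eta> :: 'e
  proof -
    have "complex_vector.span (h ` \<Lambda>) \<subseteq> {\<eta>. basis_vec i \<otimes> \<eta> \<in> ?V}"
    proof (rule complex_vector.span_minimal)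
      have "basis_vec i \<otimes> (0 :: 'e) = 0" by transfer simp
      then show "complex_vector.subspace {\<eta>. basis_vec i \<otimes> \<eta> \<in> ?V}"
        by (auto simp: complex_vector.subspace_def tensor_add_right tensor_scaleC_right
            complex_vector.span_zero complex_vector.span_add complex_vector.span_scale)
    qed (auto intro!: complex_vector.span_base)
    also have "\<dots> \<subseteq> (\<lambda>\<eta>. basis_vec i \<otimes> \<eta>) -` closure ?V"
      using closure_subset by blast
    finally have "closure (complex_vector.span (h ` \<Lambda>)) \<subseteq> (\<lambda>\<eta>. basis_vec i \<otimes> \<eta>) -` closure ?V"
      by (rule closure_minimal)
        (intro continuous_closed_vimage linear_continuous_at bounded_linear_tensor closed_closure)
    then show ?thesis using h by (auto simp: orthonormal_basis_def)
  qed
  \<comment> \<open>The closure must absorb linear combinations of the tensors just obtained; sums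
    and multiples of approximating sequences show this.\<close>
  moreover have "complex_vector.subspace (closure ?V)"
    unfolding complex_vector.subspace_def
  proof (intro conjI ballI allI)
    show "0 \<in> closure ?V" using closure_subset complex_vector.span_zero by blast
    show "x + y \<in> closure ?V" if "x \<in> closure ?V" "y \<in> closure ?V" for x y
    proof -
      from that obtain X Y where XY: "\<And>k. X k \<in> ?V" "X \<longlonglongrightarrow> x" "\<And>k. Y k \<in> ?V" "Y \<longlonglongrightarrow> y"
        unfolding closure_sequential by blast
      have "(\<lambda>k. X k + Y k) \<longlonglongrightarrow> x + y"
        using XY(2,4) by (rule tendsto_add)
      moreover have "X k + Y k \<in> ?V" for k
        using XY(1,3) by (rule complex_vector.span_add)
      ultimately show ?thesis
        unfolding closure_sequential by (intro exI[of _ "\<lambda>k. X k + Y k"] conjI allI)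
    qed
    show "c *\<^sub>C x \<in> closure ?V" if "x \<in> closure ?V" for c x
    proof -
      have lin: "bounded_linear (\<lambda>x :: ('i, 'e) ell2. c *\<^sub>C x)"
      proof (rule bounded_linear_intro[where K = "cmod c"])
        show "c *\<^sub>C r *\<^sub>R x = r *\<^sub>R c *\<^sub>C x" for r and x :: "('i, 'e) ell2"
          by (simp add: scaleC_scaleC mult.commute flip: scaleC_of_real)
      qed (simp_all add: scaleC_add_right norm_scaleC mult.commute)
      from that obtain X where X: "\<And>k. X k \<in> ?V" "X \<longlonglongrightarrow> x"
        unfolding closure_sequential by blast
      have "(\<lambda>k. c *\<^sub>C X k) \<longlonglongrightarrow> c *\<^sub>C x"
        using lin X(2) by (rule bounded_linear.tendsto)
      moreover have "c *\<^sub>C X k \<in> ?V" for k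
        using X(1) by (rule complex_vector.span_scale)
      ultimately show ?thesis
        unfolding closure_sequential by (intro exI[of _ "\<lambda>k. c *\<^sub>C X k"] conjI allI)
    qed
  qed
  ultimately have "complex_vector.span {basis_vec i \<otimes> \<eta> | (i :: 'i) (\<eta> :: 'e). True} \<subseteq> closure ?V"
    by (intro complex_vector.span_minimal) auto
  then have "closure (complex_vector.span {basis_vec i \<otimes> \<eta> | (i :: 'i) (\<eta> :: 'e). True}) \<subseteq> closure ?V"
    by (intro closure_minimal closed_closure)
  then show "closure ?V = UNIV"
    using basis_tensor_dense by blast
qed

section \<open>Successors and predecessors of letters and words\<close>

lemma Rep_last_letter: "Rep_letter (last_letter :: 'n::finite letter) = CARD('n)"
  by (simp add: last_letter_def Abs_letter_inverse Suc_leI)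

lemma Rep_first_letter: "Rep_letter (first_letter :: 'n::finite letter) = 1"
  by (simp add: first_letter_def Abs_letter_inverse Suc_leI)

text \<open>Excluding the last letter keeps the incremented number in \<open>{1..CARD('n)}\<close>,
  outside which \<open>Abs_letter\<close> is unspecified.\<close>

lemma Rep_next_letter:
  fixes j :: "'n::finite letter"
  assumes "j \<noteq> last_letter"
  shows "Rep_letter (next_letter j) = Rep_letter j + 1"
proof -
  have "Rep_letter j \<noteq> CARD('n)"
    using assms by (metis Rep_last_letter Rep_letter_inject)
  then show ?thesis
    using Rep_letter[of j] by (simp add: next_letter_def Abs_letter_inverse)
qed

text \<open>The bound \<open>> 1\<close> ensures that the natural-number subtraction does not
  truncate and stays in the range of letters.\<close>

lemma Rep_prev_letter:
  fixes j :: "'n::finite letter"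
  assumes "j \<noteq> first_letter"
  shows "Rep_letter (prev_letter j) = Rep_letter j - 1" and "Rep_letter j > 1"
proof -
  have "Rep_letter j \<noteq> 1"
    using assms by (metis Rep_first_letter Rep_letter_inject)
  then show "Rep_letter j > 1"
    using Rep_letter[of j] by simp
  then have "Rep_letter j - 1 \<in> {1..CARD('n)}"
    using Rep_letter[of j] by auto
  then show "Rep_letter (prev_letter j) = Rep_letter j - 1"
    by (simp add: prev_letter_def Abs_letter_inverse)
qed

lemma next_letter_neq_first: "j \<noteq> last_letter \<Longrightarrow> next_letter j \<noteq> first_letter"
  for j :: "'n::finite letter"
  using Rep_next_letter[of j] Rep_letter[of j] Rep_first_letter[where 'n = 'n] by auto

lemma prev_letter_neq_last: "j \<noteq> first_letter \<Longrightarrow> prev_letter j \<noteq> last_letter"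
  for j :: "'n::finite letter"
  using Rep_prev_letter[of j] Rep_letter[of j] Rep_last_letter[where 'n = 'n] by auto

lemma prev_next_letter: "j \<noteq> last_letter \<Longrightarrow> prev_letter (next_letter j) = j"
  by (rule Rep_letter_inject[THEN iffD1])
    (simp add: Rep_prev_letter next_letter_neq_first Rep_next_letter)

lemma next_prev_letter: "j \<noteq> first_letter \<Longrightarrow> next_letter (prev_letter j) = j"
  using Rep_prev_letter[of j]
  by (intro Rep_letter_inject[THEN iffD1]) (simp add: prev_letter_neq_last Rep_next_letter)

lemma leading_replicate_Cons: "b \<noteq> a \<Longrightarrow> leading a (replicate i a @ b # \<nu>) = i"
  by (simp add: leading_def takeWhile_append)

text \<open>Splitting at the first letter other than \<open>a\<close> gives the normal form on which
  \<open>word_succ\<close> and \<open>word_pred\<close> compute by rewriting.\<close>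

lemma word_cases_leading:
  fixes \<mu> :: "'n::finite word"
  assumes "\<exists>j\<in>set \<mu>. j \<noteq> a"
  obtains i b \<nu> where "\<mu> = replicate i a @ b # \<nu>" "b \<noteq> a"
proof -
  have "dropWhile (\<lambda>j. j = a) \<mu> \<noteq> []"
    using assms by simp
  then obtain b \<nu> where b: "dropWhile (\<lambda>j. j = a) \<mu> = b # \<nu>"
    unfolding neq_Nil_conv by blast
  have "takeWhile (\<lambda>j. j = a) \<mu> = replicate (leading a \<mu>) a"
    unfolding leading_def by (rule replicate_eqI) (auto dest: set_takeWhileD)
  moreover have "\<mu> = takeWhile (\<lambda>j. j = a) \<mu> @ b # \<nu>" "b \<noteq> a"
    using b by (simp_all add: dropWhile_eq_Cons_conv)
  ultimately show thesis
    using that[of "leading a \<mu>" b \<nu>] by simp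
qed

lemma word_succ_replicate_Cons:
  "j \<noteq> last_letter \<Longrightarrow>
    word_succ (replicate i last_letter @ j # \<nu>) = replicate i first_letter @ next_letter j # \<nu>"
  by (simp add: word_succ_def leading_replicate_Cons nth_append)

lemma word_pred_replicate_Cons:
  "j \<noteq> first_letter \<Longrightarrow>
    word_pred (replicate i first_letter @ j # \<nu>) = replicate i last_letter @ prev_letter j # \<nu>"
  by (simp add: word_pred_def leading_replicate_Cons nth_append)

text \<open>The incremented letter is never the first one, so it ends the new block of first letters
  at the same position; \<open>word_pred\<close> therefore changes the same letter back.\<close>

lemma word_pred_succ:
  assumes "\<exists>j\<in>set \<mu>. j \<noteq> last_letter"
  shows "word_pred (word_succ \<mu>) = \<mu>" and "word_succ \<mu> \<in> M0"
proof -
  obtain i j \<nu> where "\<mu> = replicate i last_letter @ j # \<nu>" "j \<noteq> last_letter"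
    using assms by (rule word_cases_leading)
  then show "word_pred (word_succ \<mu>) = \<mu>" "word_succ \<mu> \<in> M0"
    by (simp_all add: M0_def word_succ_replicate_Cons word_pred_replicate_Cons
        next_letter_neq_first prev_next_letter)
qed

lemma word_succ_pred:
  assumes "\<gamma> \<in> M0"
  shows "word_succ (word_pred \<gamma>) = \<gamma>" and "\<exists>j\<in>set (word_pred \<gamma>). j \<noteq> last_letter"
proof -
  obtain i j \<nu> where "\<gamma> = replicate i first_letter @ j # \<nu>" "j \<noteq> first_letter"
    using assms word_cases_leading[of \<gamma> first_letter] unfolding M0_def by blast
  then show "word_succ (word_pred \<gamma>) = \<gamma>" "\<exists>j\<in>set (word_pred \<gamma>). j \<noteq> last_letter"
    by (simp_all add: word_succ_replicate_Cons word_pred_replicate_Cons prev_letter_neq_last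
        next_prev_letter)
qed

text \<open>Turns the prefix test in \<open>left_tensor\<close> into the upper summation bound of
  the adjoint formula.\<close>

lemma take_eq_replicate_iff: "take m \<gamma> = replicate m a \<longleftrightarrow> m \<le> leading a \<gamma>"
proof (induction m arbitrary: \<gamma>)
  case (Suc m)
  then show ?case by (cases \<gamma>) (auto simp: leading_def)
qed simp

section \<open>The adjoint of the odometer map\<close>

lemma cadjoint_odometer_map:
  fixes L :: "'e::chilbert_space \<Rightarrow> ('n::finite, 'e) fock_tensor"
    and W :: "('n, 'e) fock_tensor \<Rightarrow> ('n, 'e) fock_tensor"
    and h :: "'l \<Rightarrow> 'e"
  assumes h: "orthonormal_basis \<Lambda> h" and L: "bounded_clinear L" and W: "bounded_clinear W"
    and LW: "odometer_map L W"
  shows "cadjoint W (e[\<gamma>] \<otimes> x) = indicator M0 \<gamma> *\<^sub>C (e[word_pred \<gamma>] \<otimes> x) +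
    (\<Sum>p = 0..leading first_letter \<gamma>.
      e[replicate p last_letter] \<otimes> cadjoint L (e[drop p \<gamma>] \<otimes> x))" (is "_ = ?R")
proof (rule ell2_eqI)
  fix \<mu> :: "'n word" and \<eta> :: 'e
  have adj: "cinner (e[\<mu>] \<otimes> \<eta>) (cadjoint W (e[\<gamma>] \<otimes> x)) = cinner (W (e[\<mu>] \<otimes> \<eta>)) (e[\<gamma>] \<otimes> x)"
    by (rule cinner_cadjoint[OF W orthonormal_basis_tensor[OF h], symmetric])
  \<comment> \<open>A summand contributes only if \<open>\<mu>\<close> is the matching power of the
    last letter, and there the adjoint of \<open>L\<close> moves back to \<open>L\<close>. The
    indicator is real, so conjugation leaves it unchanged.\<close>
  have R: "cinner (e[\<mu>] \<otimes> \<eta>) ?R =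
      indicator M0 \<gamma> * (if \<mu> = word_pred \<gamma> then cinner \<eta> x else 0) +
      (\<Sum>p = 0..leading first_letter \<gamma>.
        if \<mu> = replicate p last_letter then cinner (L \<eta>) (e[drop p \<gamma>] \<otimes> x) else 0)"
    by (auto simp: cinner_add_right cinner_sum_right cinner_scaleC_right indicator_def
        cinner_basis_tensor_basis_tensor cinner_cadjoint[OF L h] intro!: sum.cong)
  show "cinner (e[\<mu>] \<otimes> \<eta>) (cadjoint W (e[\<gamma>] \<otimes> x)) = cinner (e[\<mu>] \<otimes> \<eta>) ?R"
  proof (cases "\<exists>j\<in>set \<mu>. j \<noteq> last_letter")
    case True
    then have "W (e[\<mu>] \<otimes> \<eta>) = e[word_succ \<mu>] \<otimes> \<eta>"
      using LW by (simp add: odometer_map_def)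
    \<comment> \<open>By this equivalence the left pairing equals that with the predecessor term;
      the sum over \<open>p\<close> vanishes.\<close>
    moreover have "word_succ \<mu> = \<gamma> \<longleftrightarrow> \<gamma> \<in> M0 \<and> \<mu> = word_pred \<gamma>"
      using word_pred_succ[OF True] word_succ_pred[of \<gamma>] by auto
    moreover have "\<mu> \<noteq> replicate p last_letter" for p
      using True by auto
    ultimately show ?thesis
      unfolding adj R by (auto simp: cinner_basis_tensor_basis_tensor)
  next
    case False
    define m where "m = length \<mu>"
    have \<mu>: "\<mu> = replicate m last_letter"
      unfolding m_def using False by (metis replicate_eqI)
    have "W (e[\<mu>] \<otimes> \<eta>) = left_tensor (replicate m first_letter) (L \<eta>)"
    \<comment> \<open>The empty word has its own clause in \<open>odometer_map\<close>; it fits the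
      formula because \<open>left_tensor []\<close> is the identity.\<close>
    proof (cases "m = 0")
      case True
      have "left_tensor [] (L \<eta>) = L \<eta>" by transfer simp
      then show ?thesis using LW \<mu> True by (simp add: odometer_map_def)
    next
      case False
      then have "m \<ge> 1" by simp
      then show ?thesis using LW unfolding odometer_map_def \<mu> by blast
    qed
    then have "cinner (W (e[\<mu>] \<otimes> \<eta>)) (e[\<gamma>] \<otimes> x) =
        (if m \<le> leading first_letter \<gamma> then cinner (L \<eta>) (e[drop m \<gamma>] \<otimes> x) else 0)"
      by (simp add: cinner_basis_tensor_right left_tensor.rep_eq take_eq_replicate_iff)
    \<comment> \<open>The predecessor of a word in \<open>M0\<close> has a letter other than the
      last one, so it cannot be \<open>\<mu>\<close>.\<close>
    moreover have "indicator M0 \<gamma> * (if \<mu> = word_pred \<gamma> then cinner \<eta> x else 0) = 0"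
      using False word_succ_pred(2)[of \<gamma>] by (auto simp: indicator_def)
    \<comment> \<open>The sum collapses to \<open>p = m\<close>, which lies in its range exactly
      when the prefix condition holds.\<close>
    moreover have "\<mu> = replicate p last_letter \<longleftrightarrow> p = m" for p
      by (auto simp: \<mu>)
    ultimately show ?thesis
      unfolding adj R by simp
  qed
qed

theorem theorem6p2:
  fixes h :: "'l \<Rightarrow> 'e::chilbert_space" and \<Lambda> :: "'l set"
    and L :: "'e \<Rightarrow> ('n::finite, 'e) fock_tensor"
    and W :: "('n, 'e) fock_tensor \<Rightarrow> ('n, 'e) fock_tensor"
    and \<gamma> :: "'n word" and l :: 'l
  assumes "countable \<Lambda>" and "orthonormal_basis \<Lambda> h"
    and "bounded_clinear L" and "bounded_clinear W" and "odometer_map L W"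
    and "l \<in> \<Lambda>"
  shows
    "(\<forall>p \<le> leading first_letter \<gamma>.
        (\<lambda>q. cnj (odometer_coeff L h q (drop p \<gamma>) l) *\<^sub>C (e[replicate p last_letter] \<otimes> h q))
          summable_on \<Lambda>) \<and>
     cadjoint W (e[\<gamma>] \<otimes> h l) =
       indicator M0 \<gamma> *\<^sub>C (e[word_pred \<gamma>] \<otimes> h l) +
       (\<Sum>p = 0..leading first_letter \<gamma>. \<Sum>\<^sub>\<infinity>q\<in>\<Lambda>.
          cnj (odometer_coeff L h q (drop p \<gamma>) l) *\<^sub>C (e[replicate p last_letter] \<otimes> h q)) \<and>
     cadjoint W (e[\<gamma>] \<otimes> h l) =
       indicator M0 \<gamma> *\<^sub>C (e[word_pred \<gamma>] \<otimes> h l) +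
       (\<Sum>p = 0..leading first_letter \<gamma>.
          e[replicate p last_letter] \<otimes> cadjoint L (e[drop p \<gamma>] \<otimes> h l))"
proof -
  note h = \<open>orthonormal_basis \<Lambda> h\<close> and L = \<open>bounded_clinear L\<close>
  \<comment> \<open>Tensoring the series for the adjoint of \<open>L\<close> term by term gives at
    once the summability claim and the values of the inner sums, so the first formula reduces to the
    second.\<close>
  have sums: "((\<lambda>q. cnj (odometer_coeff L h q (drop p \<gamma>) l) *\<^sub>C (e[replicate p last_letter] \<otimes> h q))
      has_sum e[replicate p last_letter] \<otimes> cadjoint L (e[drop p \<gamma>] \<otimes> h l)) \<Lambda>" for p
    using has_sum_bounded_linear[OF bounded_linear_tensor has_sum_cadjoint[OF L h]]
    by (simp add: o_def tensor_scaleC_right odometer_coeff_def)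
  show ?thesis
    using cadjoint_odometer_map[OF h L \<open>bounded_clinear W\<close> \<open>odometer_map L W\<close>, of \<gamma> "h l"]
    by (simp add: infsumI[OF sums] has_sum_imp_summable[OF sums])
qed

end
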